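(* Let $n\ge 1$ be an integer and let $B_n^2$ be the strong prism of the linear polyomino chain $B_n$ with $n$ squares. Then the degree-Kirchhoff index of $B_n^2$ is $$Kf^*(B_n^2)=\frac{\sqrt{3}(7n-9)(7n+3)\left[(2+\sqrt{3})^{n+1}+(2-\sqrt{3})^{n+1}\right]-4(7n+3)\left[(2+\sqrt{3})^{n}-(2-\sqrt{3})^{n}\right]}{3\left[(2+\sqrt{3})^{n+1}-(2-\sqrt{3})^{n+1}\right]}+\frac{49}{3}n^3+70n^2+141n+46.$$
   Context: All graphs are simple and undirected. The linear polyomino chain $B_n$ with $n$ squares is the graph with $2n+2$ vertices $u_1,\dots,u_{n+1},v_1,\dots,v_{n+1}$ and $3n+1$ edges: $u_iu_{i+1}$ and $v_iv_{i+1}$ for $1\le i\le n$, and $u_iv_i$ for $1\le i\le n+1$. The strong product $G\boxtimes H$ of graphs $G$ and $H$ has vertex set $V(G)\times V(H)$, where two distinct vertices $(a_1,b_1)$ and $(a_2,b_2)$ are adjacent whenever $a_1,a_2$ are equal or adjacent in $G$ and $b_1,b_2$ are equal or adjacent in $H$. The strong prism of $G$ is the strong product of $G$ and $K_2$ (the complete graph on two vertices). $B_n^2$ denotes the strong prism of $B_n$; it has $4n+4$ vertices and $2(7n+3)$ edges. For a connected graph $G$ with vertices labeled $1,\dots,N$, let $d_i$ be the degree of vertex $i$ and let $r_{ij}$ be the resistance distance between vertices $i$ and $j$, i.e. the effective resistance between $i$ and $j$ in the electrical network obtained by placing a unit resistor on each edge of $G$. The degree-Kirchhoff index is $Kf^*(G)=\sum_{i<j}d_id_jr_{ij}$.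 *)

theory Defs
  imports Complex_Main "Graph_Theory.Graph_Theory"
begin

text \<open>
  A simple undirected graph is a \<^locale>\<open>pair_graph\<close>: a finite, loop-free, symmetric digraph
  without parallel arcs, in which each undirected edge is represented by two opposite arcs.
  In such a graph the degree of a vertex is its \<^const>\<open>out_degree\<close>.
\<close>

datatype chain_vertex = U nat | V nat

definition polyomino_chain_edges :: "nat \<Rightarrow> (chain_vertex \<times> chain_vertex) set" where
  "polyomino_chain_edges n =
     {(U i, U (i + 1)) | i. 1 \<le> i \<and> i \<le> n} \<union>
     {(V i, V (i + 1)) | i. 1 \<le> i \<and> i \<le> n} \<union>
     {(U i, V i) | i. 1 \<le> i \<and> i \<le> n + 1}"

definition polyomino_chain :: "nat \<Rightarrow> chain_vertex pair_pre_digraph" where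
  "polyomino_chain n =
     \<lparr> pverts = U ` {1..n + 1} \<union> V ` {1..n + 1},
       parcs = polyomino_chain_edges n \<union> (polyomino_chain_edges n)\<inverse> \<rparr>"

definition strong_product ::
    "'a pair_pre_digraph \<Rightarrow> 'b pair_pre_digraph \<Rightarrow> ('a \<times> 'b) pair_pre_digraph" where
  "strong_product G H =
     \<lparr> pverts = pverts G \<times> pverts H,
       parcs = {((a1, b1), (a2, b2)) | a1 b1 a2 b2.
         a1 \<in> pverts G \<and> a2 \<in> pverts G \<and> b1 \<in> pverts H \<and> b2 \<in> pverts H \<and>
         (a1, b1) \<noteq> (a2, b2) \<and>
         (a1 = a2 \<or> (a1, a2) \<in> parcs G) \<and> (b1 = b2 \<or> (b1, b2) \<in> parcs H)} \<rparr>"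

definition K2 :: "bool pair_pre_digraph" where
  "K2 = \<lparr> pverts = UNIV, parcs = {(a, b). a \<noteq> b} \<rparr>"

definition strong_prism :: "'a pair_pre_digraph \<Rightarrow> ('a \<times> bool) pair_pre_digraph" where
  "strong_prism G = strong_product G K2"

text \<open>
  Place a unit resistor on each edge. By Ohm's law the current through an edge from \<open>v\<close> to \<open>w\<close>
  is \<open>\<phi> v - \<phi> w\<close>. The predicate below is Kirchhoff's current law when one unit of current
  is injected at \<open>a\<close> and extracted at \<open>b\<close>; for \<open>a = b\<close> the two external currents cancel.
\<close>
definition unit_current_potential ::
    "'a pair_pre_digraph \<Rightarrow> 'a \<Rightarrow> 'a \<Rightarrow> ('a \<Rightarrow> real) \<Rightarrow> bool" where
  "unit_current_potential G a b \<phi> \<longleftrightarrow>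
     (\<forall>v \<in> pverts G. (\<Sum>w \<in> {w. (v, w) \<in> parcs G}. \<phi> v - \<phi> w) =
        (if v = a then 1 else 0) - (if v = b then 1 else 0))"

text \<open>
  In a connected graph such a potential exists and is unique up to an additive constant, so the
  potential difference below is well-defined. It carries no meaning for disconnected graphs.
\<close>
definition resistance_distance :: "'a pair_pre_digraph \<Rightarrow> 'a \<Rightarrow> 'a \<Rightarrow> real" where
  "resistance_distance G a b =
     (THE r. \<exists>\<phi>. unit_current_potential G a b \<phi> \<and> r = \<phi> a - \<phi> b)"

text \<open>The function \<open>l\<close> labels the vertices of \<open>G\<close> by \<open>1, \<dots>, N\<close>.\<close>
definition degree_kirchhoff_index :: "'a pair_pre_digraph \<Rightarrow> (nat \<Rightarrow> 'a) \<Rightarrow> real" where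
  "degree_kirchhoff_index G l =
     (\<Sum>(i, j) \<in> {(i, j). 1 \<le> i \<and> i < j \<and> j \<le> card (pverts G)}.
        real (out_degree G (l i)) * real (out_degree G (l j)) *
        resistance_distance G (l i) (l j))"

lemma polyomino_chain_pair_graph: "pair_graph (polyomino_chain n)"
proof
  have fin: "finite (pverts (polyomino_chain n))"
    by (simp add: polyomino_chain_def)
  have sub: "parcs (polyomino_chain n) \<subseteq> pverts (polyomino_chain n) \<times> pverts (polyomino_chain n)"
    by (auto simp: polyomino_chain_def polyomino_chain_edges_def)
  show "finite (pverts (polyomino_chain n))" by (rule fin)
  show "finite (parcs (polyomino_chain n))"
    using fin sub by (meson finite_SigmaI finite_subset)
  show "fst e \<in> pverts (polyomino_chain n)" "snd e \<in> pverts (polyomino_chain n)"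
    if "e \<in> parcs (polyomino_chain n)" for e using sub that by auto
  show "fst e \<noteq> snd e" if "e \<in> parcs (polyomino_chain n)" for e
    using that by (auto simp: polyomino_chain_def polyomino_chain_edges_def)
  show "symmetric (polyomino_chain n)"
    by (auto simp: symmetric_def polyomino_chain_def sym_Un_converse)
qed

lemma K2_complete: "complete_digraph 2 (with_proj K2)"
  by (auto simp: complete_digraph_pair_def K2_def)

lemma strong_product_pair_graph:
  assumes "pair_graph G" and "pair_graph H"
  shows "pair_graph (strong_product G H)"
proof
  interpret G: pair_graph G by fact
  interpret H: pair_graph H by fact
  have symG: "(y, x) \<in> parcs G" if "(x, y) \<in> parcs G" for x y
    using G.pair_sym_arcs that by (auto simp: symmetric_def sym_def)
  have symH: "(y, x) \<in> parcs H" if "(x, y) \<in> parcs H" for x y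
    using H.pair_sym_arcs that by (auto simp: symmetric_def sym_def)
  have fin: "finite (pverts (strong_product G H))"
    using G.pair_finite_verts H.pair_finite_verts by (simp add: strong_product_def)
  have sub: "parcs (strong_product G H) \<subseteq> pverts (strong_product G H) \<times> pverts (strong_product G H)"
    by (auto simp: strong_product_def)
  show "finite (pverts (strong_product G H))" by (rule fin)
  show "finite (parcs (strong_product G H))"
    using fin sub by (meson finite_SigmaI finite_subset)
  show "fst e \<in> pverts (strong_product G H)" "snd e \<in> pverts (strong_product G H)"
    if "e \<in> parcs (strong_product G H)" for e using sub that by auto
  show "fst e \<noteq> snd e" if "e \<in> parcs (strong_product G H)" for e
    using that by (auto simp: strong_product_def)
  show "symmetric (strong_product G H)"
    by (auto simp: symmetric_def strong_product_def intro!: symI symG symH)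
qed

lemma card_strong_prism_polyomino_chain:
  "card (pverts (strong_prism (polyomino_chain n))) = 4 * n + 4"
proof -
  have "card (U ` {1..n + 1} \<union> V ` {1..n + 1}) = card (U ` {1..n + 1}) + card (V ` {1..n + 1})"
    by (intro card_Un_disjoint) auto
  also have "\<dots> = 2 * n + 2" by (simp add: card_image inj_on_def)
  finally show ?thesis
    by (simp add: strong_prism_def strong_product_def polyomino_chain_def K2_def
        card_cartesian_product del: image_Suc_atLeastAtMost)
qed

end

theory Submission
  imports Defs
begin

text \<open>
  Suppose that \<open>g\<close> inverts the graph Laplacian \<open>L\<close> up to a sink \<open>c\<close> that does not depend on the
  source: \<open>L (g(\<cdot>, y)) = \<delta>\<^sub>y - c\<close>. Then \<open>g(\<cdot>, a) - g(\<cdot>, b)\<close> is a potential for the unit current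
  from \<open>a\<close> to \<open>b\<close>, so that \<open>r(a, b) = g(a, a) + g(b, b) - g(a, b) - g(b, a)\<close>, and the
  degree-Kirchhoff index becomes \<open>(\<Sum>\<^sub>x d\<^sub>x) (\<Sum>\<^sub>x d\<^sub>x g(x, x)) - \<Sum>\<^sub>x\<^sub>,\<^sub>y d\<^sub>x d\<^sub>y g(x, y)\<close>
  (\<open>degree_kirchhoff_index_green_function\<close>). It remains to find \<open>g\<close> and to evaluate three sums.

  The symmetries of the graph split functions on it into three kinds.
  Exchanging the two copies of a vertex \<open>u\<close> of the base graph (its twins) is an automorphism
  of any strong prism. On a function that is odd under the twin exchange the
  contributions of neighbouring twin pairs cancel, and the Laplacian multiplies it
  by \<open>2 (deg u + 1)\<close> at \<open>u\<close>. On even functions it acts as twice the Laplacian of the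
  base graph. So a Green's function of the base graph yields one of the
  prism (\<open>green_function_strong_prism\<close>).

  The chain is itself a ladder, with the exchange of its two sides as a further automorphism. With
  \<open>N = n + 1\<close> columns, even functions see the Laplacian \<open>P\<close> of the path on \<open>N\<close> vertices, for which
  \<open>- \<bar>i - j\<bar> / 2\<close> is a Green's function, and odd functions see the invertible operator \<open>P + 2\<close>.
  The equation \<open>(P + 2) f = 0\<close> reads \<open>f(i + 1) = 4 f(i) - f(i - 1)\<close>, with characteristic roots
  \<open>2 \<plusminus> \<surd>3\<close>. The inverse of \<open>P + 2\<close> is the product of a solution adapted to the left end and one
  adapted to the right end, divided by their Wronskian, a multiple of
  \<open>(2 + \<surd>3)\<^sup>N - (2 - \<surd>3)\<^sup>N\<close>: this is where the denominator of the formula comes from.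

  In the double sum all odd parts cancel and the weighted sum of the distances
  \<open>\<bar>i - j\<bar>\<close> remains, which is a polynomial in \<open>n\<close>. In the diagonal sum the distances vanish; what
  remains is the trace of the inverse of \<open>P + 2\<close>, corrected at the two ends where the degree is
  \<open>5\<close> instead of \<open>7\<close> (\<open>sum_rung_green\<close>, \<open>rung_green_ends\<close>), and a rational contribution of the
  twins.
\<close>

section \<open>Resistance distances from a Green's function\<close>

definition laplacian :: "'a pair_pre_digraph \<Rightarrow> ('a \<Rightarrow> real) \<Rightarrow> 'a \<Rightarrow> real" where
  "laplacian G f v = (\<Sum>w \<in> {w. (v, w) \<in> parcs G}. f v - f w)"

definition degree :: "'a pair_pre_digraph \<Rightarrow> 'a \<Rightarrow> real" where
  "degree G v = real (card {w. (v, w) \<in> parcs G})"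

text \<open>
  The Laplacian kills constants and has range orthogonal to them, so it has no inverse. The sink \<open>c\<close>
  is left arbitrary, since the sink that is natural for a path sits at its two ends.
\<close>

definition green_function ::
    "'a pair_pre_digraph \<Rightarrow> ('a \<Rightarrow> 'a \<Rightarrow> real) \<Rightarrow> ('a \<Rightarrow> real) \<Rightarrow> bool" where
  "green_function G g c \<longleftrightarrow>
     (\<forall>x \<in> pverts G. \<forall>y \<in> pverts G. laplacian G (\<lambda>z. g z y) x = of_bool (x = y) - c x)"

lemma out_degree_eq_degree: "real (out_degree (with_proj G) v) = degree G v"
proof -
  have "out_arcs (with_proj G) v = Pair v ` {w. (v, w) \<in> parcs G}"
    by (auto simp: out_arcs_def)
  then show ?thesis
    by (simp add: out_degree_def degree_def card_image inj_on_def)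
qed

lemma finite_neighbours:
  assumes "pair_graph G"
  shows "finite {w. (v, w) \<in> parcs G}"
proof -
  interpret pair_graph G by fact
  have "{w. (v, w) \<in> parcs G} \<subseteq> snd ` parcs G" by force
  then show ?thesis by (rule finite_subset) simp
qed

lemma laplacian_as_vertex_sum:
  assumes "pair_graph G"
  shows "laplacian G f v = (\<Sum>w \<in> pverts G. of_bool ((v, w) \<in> parcs G) * (f v - f w))"
proof -
  interpret pair_graph G by fact
  have "w \<in> pverts G" if "(v, w) \<in> parcs G" for w
    using that in_arcsD2 by blast
  then have "{w. (v, w) \<in> parcs G} = {w \<in> pverts G. (v, w) \<in> parcs G}" by auto
  then have "laplacian G f v = (\<Sum>w \<in> {w \<in> pverts G. (v, w) \<in> parcs G}. f v - f w)"
    by (simp add: laplacian_def)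
  also have "\<dots> = (\<Sum>w \<in> pverts G. if (v, w) \<in> parcs G then f v - f w else 0)"
    by (simp add: sum.inter_filter)
  also have "\<dots> = (\<Sum>w \<in> pverts G. of_bool ((v, w) \<in> parcs G) * (f v - f w))"
    by (intro sum.cong) auto
  finally show ?thesis .
qed

text \<open>
  Both sides expand into sums over ordered pairs of adjacent vertices, and reversing all pairs
  exchanges the cross terms.
\<close>

lemma laplacian_self_adjoint:
  assumes "pair_graph G"
  shows "(\<Sum>v \<in> pverts G. f v * laplacian G h v) = (\<Sum>v \<in> pverts G. h v * laplacian G f v)"
proof -
  interpret pair_graph G by fact
  have sym: "(w, v) \<in> parcs G \<longleftrightarrow> (v, w) \<in> parcs G" for v w
    using pair_sym_arcs by (auto simp: symmetric_def sym_def)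
  let ?e = "\<lambda>v w. of_bool ((v, w) \<in> parcs G) :: real"
  have swap: "(\<Sum>v \<in> pverts G. \<Sum>w \<in> pverts G. ?e v w * (f v * h w))
      = (\<Sum>v \<in> pverts G. \<Sum>w \<in> pverts G. ?e v w * (h v * f w))"
    by (subst sum.swap) (simp add: sym mult.commute)
  have split: "(\<Sum>v \<in> pverts G. f' v * laplacian G h' v)
     = (\<Sum>v \<in> pverts G. \<Sum>w \<in> pverts G. ?e v w * (f' v * h' v))
       - (\<Sum>v \<in> pverts G. \<Sum>w \<in> pverts G. ?e v w * (f' v * h' w))" for f' h' :: "'a \<Rightarrow> real"
    by (simp add: laplacian_as_vertex_sum[OF assms] sum_distrib_left sum_subtractf[symmetric]
        algebra_simps)
  show ?thesis
    unfolding split using swap by (simp add: mult.commute)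
qed

lemma sum_mult_delta:
  fixes f :: "'a \<Rightarrow> real"
  assumes "finite A" and "a \<in> A"
  shows "(\<Sum>x \<in> A. f x * of_bool (x = a)) = f a"
proof -
  have "(\<Sum>x \<in> A. f x * of_bool (x = a)) = (\<Sum>x \<in> A. if x = a then f x else 0)"
    by (intro sum.cong) auto
  then show ?thesis using assms by simp
qed

text \<open>
  The potential difference is unique because \<open>g\<close> determines it: pairing an arbitrary potential
  \<open>\<phi>\<close> with \<open>g(\<cdot>, y)\<close> and moving the Laplacian from one factor to the other expresses \<open>\<phi> y\<close>
  through \<open>g\<close>, up to a constant that does not depend on \<open>y\<close>.
\<close>

lemma resistance_distance_green_function:
  assumes G: "pair_graph G" and g: "green_function G g c"
    and a: "a \<in> pverts G" and b: "b \<in> pverts G"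
  shows "resistance_distance G a b = g a a + g b b - g a b - g b a"
proof -
  interpret pair_graph G by fact
  have ucp: "unit_current_potential G a b \<phi> \<longleftrightarrow>
      (\<forall>v \<in> pverts G. laplacian G \<phi> v = of_bool (v = a) - of_bool (v = b))" for \<phi>
    by (simp add: unit_current_potential_def laplacian_def of_bool_def)
  have lap_diff: "laplacian G (\<lambda>z. g z a - g z b) v
      = laplacian G (\<lambda>z. g z a) v - laplacian G (\<lambda>z. g z b) v" for v
    by (simp add: laplacian_def sum_subtractf[symmetric] algebra_simps)
  have pot: "unit_current_potential G a b (\<lambda>z. g z a - g z b)"
    using g a b by (simp add: ucp lap_diff green_function_def)
  have uniq: "\<phi> a - \<phi> b = g a a + g b b - g a b - g b a"
    if "unit_current_potential G a b \<phi>" for \<phi>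
  proof -
    have pairing: "g a y - g b y = \<phi> y - (\<Sum>v \<in> pverts G. \<phi> v * c v)"
      if y: "y \<in> pverts G" for y
    proof -
      have "g a y - g b y = (\<Sum>v \<in> pverts G. g v y * (of_bool (v = a) - of_bool (v = b)))"
        using a b by (simp add: right_diff_distrib sum_subtractf sum_mult_delta)
      also have "\<dots> = (\<Sum>v \<in> pverts G. g v y * laplacian G \<phi> v)"
        using \<open>unit_current_potential G a b \<phi>\<close> by (simp add: ucp)
      also have "\<dots> = (\<Sum>v \<in> pverts G. \<phi> v * laplacian G (\<lambda>z. g z y) v)"
        by (rule laplacian_self_adjoint[OF G])
      also have "\<dots> = (\<Sum>v \<in> pverts G. \<phi> v * (of_bool (v = y) - c v))"
        using g y by (simp add: green_function_def)
      also have "\<dots> = \<phi> y - (\<Sum>v \<in> pverts G. \<phi> v * c v)"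
        using y by (simp add: right_diff_distrib sum_subtractf sum_mult_delta)
      finally show ?thesis .
    qed
    show ?thesis using pairing[OF a] pairing[OF b] by simp
  qed
  show ?thesis
    unfolding resistance_distance_def
  proof (rule the_equality)
    show "\<exists>\<phi>. unit_current_potential G a b \<phi> \<and> g a a + g b b - g a b - g b a = \<phi> a - \<phi> b"
      using pot uniq[OF pot] by auto
  qed (use uniq in auto)
qed

lemma sum_pairs_symmetric:
  fixes F :: "nat \<Rightarrow> nat \<Rightarrow> real"
  assumes "\<And>i j. F i j = F j i" and "\<And>i. F i i = 0"
  shows "2 * (\<Sum>(i, j) \<in> {(i, j). 1 \<le> i \<and> i < j \<and> j \<le> N}. F i j) = (\<Sum>i=1..N. \<Sum>j=1..N. F i j)"
proof -
  let ?A = "{(i, j). 1 \<le> i \<and> i < j \<and> j \<le> N}"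
  let ?B = "{(i, j). 1 \<le> j \<and> j < i \<and> i \<le> N}"
  let ?D = "(\<lambda>i. (i, i)) ` {1..N}"
  have fin: "finite ?A" "finite ?B"
    by (rule finite_subset[of _ "{1..N} \<times> {1..N}"]; auto)+
  have "?B = prod.swap ` ?A" by auto
  then have BA: "(\<Sum>(i, j) \<in> ?B. F i j) = (\<Sum>(i, j) \<in> ?A. F i j)"
    using assms(1) by (simp add: sum.reindex case_prod_beta)
  have D: "(\<Sum>(i, j) \<in> ?D. F i j) = 0"
    by (rule sum.neutral) (auto simp: assms(2))
  have "{1..N} \<times> {1..N} = ?A \<union> ?B \<union> ?D" by auto
  then have "(\<Sum>i=1..N. \<Sum>j=1..N. F i j) = (\<Sum>(i, j) \<in> ?A \<union> ?B \<union> ?D. F i j)"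
    by (simp add: sum.cartesian_product)
  also have "\<dots> = (\<Sum>(i, j) \<in> ?A \<union> ?B. F i j) + (\<Sum>(i, j) \<in> ?D. F i j)"
    using fin by (intro sum.union_disjoint) auto
  also have "(\<Sum>(i, j) \<in> ?A \<union> ?B. F i j) = (\<Sum>(i, j) \<in> ?A. F i j) + (\<Sum>(i, j) \<in> ?B. F i j)"
    using fin by (intro sum.union_disjoint) auto
  finally show ?thesis using BA D by simp
qed

text \<open>
  The resistance is symmetric and vanishes on the diagonal, so twice the index is a sum over all
  ordered pairs of vertices; there the labelling disappears and the four terms of the resistance
  can be summed separately.
\<close>

lemma degree_kirchhoff_index_green_function:
  assumes G: "pair_graph G" and g: "green_function G g c"
    and l: "bij_betw l {1..card (pverts G)} (pverts G)"
  shows "degree_kirchhoff_index G l =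
    (\<Sum>x \<in> pverts G. degree G x) * (\<Sum>x \<in> pverts G. degree G x * g x x)
    - (\<Sum>x \<in> pverts G. \<Sum>y \<in> pverts G. degree G x * degree G y * g x y)"
proof -
  let ?N = "card (pverts G)" and ?V = "pverts G" and ?d = "degree G"
  define r where "r x y = ?d x * ?d y * (g x x + g y y - g x y - g y x)" for x y
  have lV: "l i \<in> ?V" if "i \<in> {1..?N}" for i
    using l that by (auto simp: bij_betw_def)
  have "degree_kirchhoff_index G l
      = (\<Sum>(i, j) \<in> {(i, j). 1 \<le> i \<and> i < j \<and> j \<le> ?N}. r (l i) (l j))"
    unfolding degree_kirchhoff_index_def
  proof (rule sum.cong[OF refl], clarify)
    fix i j :: nat assume ij: "1 \<le> i" "i < j" "j \<le> ?N"
    show "real (out_degree (with_proj G) (l i)) * real (out_degree (with_proj G) (l j))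
        * resistance_distance G (l i) (l j) = r (l i) (l j)"
      using ij lV[of i] lV[of j]
      by (simp add: r_def out_degree_eq_degree resistance_distance_green_function[OF G g])
  qed
  then have "2 * degree_kirchhoff_index G l = (\<Sum>i=1..?N. \<Sum>j=1..?N. r (l i) (l j))"
    using sum_pairs_symmetric[of "\<lambda>i j. r (l i) (l j)" ?N] by (simp add: r_def algebra_simps)
  also have "\<dots> = (\<Sum>x \<in> ?V. \<Sum>y \<in> ?V. r x y)"
    by (subst sum.reindex_bij_betw[OF l]) (rule sum.reindex_bij_betw[OF l])
  also have "\<dots> = (\<Sum>x \<in> ?V. \<Sum>y \<in> ?V. ?d y * (?d x * g x x)) + (\<Sum>x \<in> ?V. \<Sum>y \<in> ?V. ?d x * (?d y * g y y))
      - (\<Sum>x \<in> ?V. \<Sum>y \<in> ?V. ?d x * ?d y * g x y) - (\<Sum>x \<in> ?V. \<Sum>y \<in> ?V. ?d x * ?d y * g y x)"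
    by (simp add: r_def sum.distrib[symmetric] sum_subtractf[symmetric] algebra_simps)
  also have "(\<Sum>x \<in> ?V. \<Sum>y \<in> ?V. ?d y * (?d x * g x x)) = (\<Sum>x \<in> ?V. ?d x) * (\<Sum>x \<in> ?V. ?d x * g x x)"
    by (subst sum.swap) (simp add: sum_product)
  also have "(\<Sum>x \<in> ?V. \<Sum>y \<in> ?V. ?d x * (?d y * g y y)) = (\<Sum>x \<in> ?V. ?d x) * (\<Sum>x \<in> ?V. ?d x * g x x)"
    by (simp add: sum_product)
  also have "(\<Sum>x \<in> ?V. \<Sum>y \<in> ?V. ?d x * ?d y * g y x) = (\<Sum>x \<in> ?V. \<Sum>y \<in> ?V. ?d x * ?d y * g x y)"
    by (subst sum.swap) (simp add: mult_ac)
  finally show ?thesis by simp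
qed

section \<open>Strong prisms\<close>

lemma pair_graph_K2: "pair_graph K2"
  by unfold_locales (auto simp: K2_def symmetric_def sym_def)

lemma pair_graph_strong_prism:
  assumes "pair_graph G"
  shows "pair_graph (strong_prism G)"
  unfolding strong_prism_def by (intro strong_product_pair_graph assms pair_graph_K2)

lemma pverts_strong_prism: "pverts (strong_prism G) = pverts G \<times> UNIV"
  by (simp add: strong_prism_def strong_product_def K2_def)

lemma sum_pverts_strong_prism:
  fixes F :: "'a \<times> bool \<Rightarrow> real"
  shows "(\<Sum>x \<in> pverts (strong_prism G). F x) = (\<Sum>u \<in> pverts G. F (u, False) + F (u, True))"
  using sum.cartesian_product[of "\<lambda>u b. F (u, b)" UNIV "pverts G"]
  by (simp add: pverts_strong_prism UNIV_bool)

lemma sum_neighbours_strong_prism: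
  fixes F :: "'a \<times> bool \<Rightarrow> real"
  assumes "pair_graph G" and "u \<in> pverts G"
  shows "(\<Sum>w \<in> {w. ((u, b), w) \<in> parcs (strong_prism G)}. F w)
    = F (u, \<not> b) + (\<Sum>v \<in> {v. (u, v) \<in> parcs G}. F (v, False) + F (v, True))"
proof -
  interpret pair_graph G by fact
  have wf: "v \<in> pverts G" "v \<noteq> u" if "(u, v) \<in> parcs G" for v
    using that in_arcsD2 pair_no_loops by fastforce+
  have "{w. ((u, b), w) \<in> parcs (strong_prism G)}
      = insert (u, \<not> b) ({v. (u, v) \<in> parcs G} \<times> UNIV)"
    using wf assms(2) by (auto simp: strong_prism_def strong_product_def K2_def)
  moreover have "(u, \<not> b) \<notin> {v. (u, v) \<in> parcs G} \<times> (UNIV :: bool set)"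
    using wf by auto
  moreover have "(\<Sum>w \<in> {v. (u, v) \<in> parcs G} \<times> UNIV. F w)
      = (\<Sum>v \<in> {v. (u, v) \<in> parcs G}. F (v, False) + F (v, True))"
    using sum.cartesian_product[of "\<lambda>v b. F (v, b)" UNIV "{v. (u, v) \<in> parcs G}"]
    by (simp add: UNIV_bool)
  ultimately show ?thesis
    using finite_neighbours[OF assms(1)] by simp
qed

lemma degree_strong_prism:
  assumes "pair_graph G" and "u \<in> pverts G"
  shows "degree (strong_prism G) (u, b) = 2 * degree G u + 1"
  using sum_neighbours_strong_prism[OF assms, where F = "\<lambda>_. 1" and b = b] by (simp add: degree_def)

text \<open>
  The first summand inverts the even part of the Laplacian, the second one the part that is
  odd under the twin exchange. In both denominators one factor \<open>2\<close> comes from splitting the unit mass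
  at \<open>(v, b')\<close> into an even and an odd half. The other one is the factor between the Laplacians
  of prism and base graph, and the eigenvalue \<open>2 (deg u + 1)\<close> of an odd function supported on
  the twins of \<open>u\<close>, respectively.
\<close>

definition prism_green ::
    "'a pair_pre_digraph \<Rightarrow> ('a \<Rightarrow> 'a \<Rightarrow> real) \<Rightarrow> 'a \<times> bool \<Rightarrow> 'a \<times> bool \<Rightarrow> real" where
  "prism_green G g = (\<lambda>(u, b) (v, b').
     g u v / 4 + (if u = v then (if b = b' then 1 else -1) / (4 * (degree G u + 1)) else 0))"

lemma green_function_strong_prism:
  assumes G: "pair_graph G" and g: "green_function G g c"
  shows "green_function (strong_prism G) (prism_green G g) (\<lambda>(u, b). c u / 2)"
  unfolding green_function_def
proof (intro ballI)
  let ?g' = "prism_green G g"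
  fix x y assume "x \<in> pverts (strong_prism G)" "y \<in> pverts (strong_prism G)"
  then obtain u b v b' where xy: "x = (u, b)" "y = (v, b')" and u: "u \<in> pverts G" and v: "v \<in> pverts G"
    by (auto simp: pverts_strong_prism)
  have pos: "degree G u + 1 > 0"
    by (simp add: degree_def)
  let ?N = "{w. (u, w) \<in> parcs G}"
  \<comment> \<open>Summing over twins removes the odd part.\<close>
  have cancel: "?g' (w, False) y + ?g' (w, True) y = g w v / 2" for w
    by (auto simp: prism_green_def xy)
  have "laplacian (strong_prism G) (\<lambda>z. ?g' z y) x
      = ?g' (u, b) y - ?g' (u, \<not> b) y
        + (\<Sum>w \<in> ?N. 2 * ?g' (u, b) y - (?g' (w, False) y + ?g' (w, True) y))"
    unfolding laplacian_def xy(1)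
    by (subst sum_neighbours_strong_prism[OF G u]) (simp add: algebra_simps)
  also have "\<dots> = (?g' (u, b) y - ?g' (u, \<not> b) y)
        + (\<Sum>w \<in> ?N. (2 * ?g' (u, b) y - g u v / 2) + (g u v - g w v) / 2)"
    by (simp add: cancel diff_divide_distrib)
  also have "\<dots> = (?g' (u, b) y - ?g' (u, \<not> b) y) + degree G u * (2 * ?g' (u, b) y - g u v / 2)
        + laplacian G (\<lambda>z. g z v) u / 2"
    by (simp add: sum.distrib degree_def laplacian_def sum_divide_distrib)
  also have "(?g' (u, b) y - ?g' (u, \<not> b) y) + degree G u * (2 * ?g' (u, b) y - g u v / 2)
      = (if u = v then (if b = b' then 1 else -1) / 2 else 0)"
    using pos by (auto simp: prism_green_def xy divide_simps)
  also have "laplacian G (\<lambda>z. g z v) u = of_bool (u = v) - c u"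
    using g u v by (simp add: green_function_def)
  finally show "laplacian (strong_prism G) (\<lambda>z. ?g' z y) x
      = of_bool (x = y) - (case x of (u, b) \<Rightarrow> c u / 2)"
    by (auto simp: xy diff_divide_distrib)
qed

text \<open>
  The twins contribute to the diagonal sum only: twins have equal degrees, so the odd part of the
  Green's function cancels in the double sum.
\<close>

lemma degree_kirchhoff_index_strong_prism:
  assumes G: "pair_graph G" and g: "green_function G g c"
    and l: "bij_betw l {1..card (pverts (strong_prism G))} (pverts (strong_prism G))"
  defines "w \<equiv> \<lambda>u. 2 * degree G u + 1"
  shows "degree_kirchhoff_index (strong_prism G) l =
    (\<Sum>u \<in> pverts G. w u) * ((\<Sum>u \<in> pverts G. w u * g u u)
        + (\<Sum>u \<in> pverts G. w u / (degree G u + 1)))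
    - (\<Sum>u \<in> pverts G. \<Sum>v \<in> pverts G. w u * w v * g u v)"
proof -
  let ?V = "pverts G" and ?P = "strong_prism G"
  let ?g' = "prism_green G g"
  have deg: "degree ?P (u, b) = w u" if "u \<in> ?V" for u b
    using degree_strong_prism[OF G that] by (simp add: w_def)
  have D: "(\<Sum>x \<in> pverts ?P. degree ?P x) = 2 * (\<Sum>u \<in> ?V. w u)"
    by (simp add: sum_pverts_strong_prism deg sum_distrib_left)
  have trace: "(\<Sum>x \<in> pverts ?P. degree ?P x * ?g' x x)
      = ((\<Sum>u \<in> ?V. w u * g u u) + (\<Sum>u \<in> ?V. w u / (degree G u + 1))) / 2"
  proof -
    have pair: "w u * ?g' (u, False) (u, False) + w u * ?g' (u, True) (u, True)
        = (w u * g u u + w u / (degree G u + 1)) / 2" for u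
    proof -
      define r where "r = 1 / (degree G u + 1)"
      have "1 / (4 * (degree G u + 1)) = r / 4"
        by (simp only: r_def divide_divide_eq_left mult.commute)
      then have "?g' (u, b) (u, b) = (g u u + r) / 4" for b
        by (simp only: prism_green_def prod.case if_True simp_thms add_divide_distrib)
      moreover have "w u / (degree G u + 1) = w u * r"
        by (simp add: r_def)
      ultimately show ?thesis by (simp only:) (simp add: algebra_simps)
    qed
    have "(\<Sum>x \<in> pverts ?P. degree ?P x * ?g' x x)
        = (\<Sum>u \<in> ?V. (w u * g u u + w u / (degree G u + 1)) / 2)"
      unfolding sum_pverts_strong_prism by (intro sum.cong refl) (simp only: deg pair)
    then show ?thesis
      by (simp only: sum.distrib sum_divide_distrib[symmetric])
  qed
  have cancel: "(w u * w v * ?g' (u, False) (v, False) + w u * w v * ?g' (u, False) (v, True))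
      + (w u * w v * ?g' (u, True) (v, False) + w u * w v * ?g' (u, True) (v, True))
      = w u * w v * g u v" for u v
    by (auto simp: prism_green_def algebra_simps)
  have "(\<Sum>x \<in> pverts ?P. \<Sum>y \<in> pverts ?P. degree ?P x * degree ?P y * ?g' x y)
      = (\<Sum>u \<in> ?V. \<Sum>v \<in> ?V. w u * w v * g u v)"
    unfolding cancel[symmetric] by (simp add: sum_pverts_strong_prism deg sum.distrib)
  then show ?thesis
    using degree_kirchhoff_index_green_function[OF pair_graph_strong_prism[OF G]
        green_function_strong_prism[OF G g] l] D trace
    by simp
qed

section \<open>The linear polyomino chain\<close>

fun column :: "chain_vertex \<Rightarrow> nat" where
  "column (U i) = i"
| "column (V i) = i"

fun side :: "chain_vertex \<Rightarrow> real" where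
  "side (U i) = 1"
| "side (V i) = -1"

definition path_laplacian :: "nat \<Rightarrow> (nat \<Rightarrow> real) \<Rightarrow> nat \<Rightarrow> real" where
  "path_laplacian N f i =
     (if 1 < i then f i - f (i - 1) else 0) + (if i < N then f i - f (i + 1) else 0)"

lemma sum_pverts_polyomino_chain:
  fixes F :: "chain_vertex \<Rightarrow> real"
  shows "(\<Sum>x \<in> pverts (polyomino_chain n). F x) = (\<Sum>i=1..n+1. F (U i) + F (V i))"
proof -
  have "(\<Sum>x \<in> pverts (polyomino_chain n). F x)
      = (\<Sum>x \<in> U ` {1..n+1}. F x) + (\<Sum>x \<in> V ` {1..n+1}. F x)"
    unfolding polyomino_chain_def pair_pre_digraph.simps by (rule sum.union_disjoint) auto
  then show ?thesis
    by (simp add: sum.reindex inj_on_def sum.distrib del: image_Suc_atLeastAtMost)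
qed

lemma sum_neighbours_polyomino_chain:
  fixes F :: "chain_vertex \<Rightarrow> real"
  assumes "1 \<le> i" and "i \<le> n + 1"
  shows "(\<Sum>w \<in> {w. (U i, w) \<in> parcs (polyomino_chain n)}. F w)
      = F (V i) + (if 1 < i then F (U (i - 1)) else 0) + (if i < n + 1 then F (U (i + 1)) else 0)"
    and "(\<Sum>w \<in> {w. (V i, w) \<in> parcs (polyomino_chain n)}. F w)
      = F (U i) + (if 1 < i then F (V (i - 1)) else 0) + (if i < n + 1 then F (V (i + 1)) else 0)"
proof -
  have U: "{w. (U i, w) \<in> parcs (polyomino_chain n)}
      = {V i} \<union> (if 1 < i then {U (i - 1)} else {}) \<union> (if i < n + 1 then {U (i + 1)} else {})"
    using assms by (auto simp: polyomino_chain_def polyomino_chain_edges_def)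
  have V: "{w. (V i, w) \<in> parcs (polyomino_chain n)}
      = {U i} \<union> (if 1 < i then {V (i - 1)} else {}) \<union> (if i < n + 1 then {V (i + 1)} else {})"
    using assms by (auto simp: polyomino_chain_def polyomino_chain_edges_def)
  show "(\<Sum>w \<in> {w. (U i, w) \<in> parcs (polyomino_chain n)}. F w)
      = F (V i) + (if 1 < i then F (U (i - 1)) else 0) + (if i < n + 1 then F (U (i + 1)) else 0)"
    unfolding U by auto
  show "(\<Sum>w \<in> {w. (V i, w) \<in> parcs (polyomino_chain n)}. F w)
      = F (U i) + (if 1 < i then F (V (i - 1)) else 0) + (if i < n + 1 then F (V (i + 1)) else 0)"
    unfolding V by auto
qed

text \<open>
  Every function on the chain has the form \<open>f + side \<cdot> h\<close> with \<open>f\<close> and \<open>h\<close> depending on the column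
  only. A rung joins opposite sides of one column, hence it does not act on \<open>f\<close> and adds \<open>2 h\<close>.
\<close>

lemma laplacian_polyomino_chain:
  assumes "x \<in> pverts (polyomino_chain n)"
  shows "laplacian (polyomino_chain n) (\<lambda>z. f (column z) + side z * h (column z)) x
    = path_laplacian (n + 1) f (column x)
      + side x * (path_laplacian (n + 1) h (column x) + 2 * h (column x))"
proof (cases x)
  case (U i)
  then have "1 \<le> i" "i \<le> n + 1" using assms by (auto simp: polyomino_chain_def)
  then show ?thesis
    unfolding U laplacian_def by (subst sum_neighbours_polyomino_chain) (auto simp: path_laplacian_def)
next
  case (V i)
  then have "1 \<le> i" "i \<le> n + 1" using assms by (auto simp: polyomino_chain_def)
  then show ?thesis
    unfolding V laplacian_def by (subst sum_neighbours_polyomino_chain) (auto simp: path_laplacian_def)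
qed

lemma degree_polyomino_chain:
  assumes "n \<ge> 1" and "x \<in> pverts (polyomino_chain n)"
  shows "degree (polyomino_chain n) x = 3 - of_bool (column x = 1) - of_bool (column x = n + 1)"
proof -
  have deg: "degree (polyomino_chain n) x = (\<Sum>w \<in> {w. (x, w) \<in> parcs (polyomino_chain n)}. 1)"
    by (simp add: degree_def)
  show ?thesis
  proof (cases x)
    case (U i)
    then have "1 \<le> i" "i \<le> n + 1" using assms by (auto simp: polyomino_chain_def)
    then show ?thesis
      using assms(1) unfolding deg unfolding U by (subst sum_neighbours_polyomino_chain) auto
  next
    case (V i)
    then have "1 \<le> i" "i \<le> n + 1" using assms by (auto simp: polyomino_chain_def)
    then show ?thesis
      using assms(1) unfolding deg unfolding V by (subst sum_neighbours_polyomino_chain) auto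
  qed
qed

text \<open>
  The slope of \<open>- \<bar>k - j\<bar> / 2\<close> drops by \<open>1\<close> at \<open>j\<close>. Half of this unit current leaves
  through each end of the path, wherever \<open>j\<close> is.
\<close>

lemma path_laplacian_distance:
  assumes "1 \<le> i" "i \<le> N" "1 \<le> j" "j \<le> N"
  shows "path_laplacian N (\<lambda>k. - \<bar>real k - real j\<bar> / 2) i
    = of_bool (i = j) - (of_bool (i = 1) + of_bool (i = N)) / 2"
proof -
  consider "i < j" | "i = j" | "i > j" by linarith
  then show ?thesis
    using assms by cases (auto simp: path_laplacian_def of_nat_diff abs_if field_simps)
qed

section \<open>The screened Laplacian of the path\<close>

text \<open>
  The solution of \<open>f (k + 1) = 4 f k - f (k - 1)\<close> with \<open>f 0 = f 1 = 1\<close>. Equality of these two values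
  makes the missing neighbour of column \<open>1\<close> harmless: a fictitious column \<open>0\<close> carrying the same
  value contributes nothing to the path Laplacian.
\<close>

definition rung_mode :: "nat \<Rightarrow> real" where
  "rung_mode k = ((3 - sqrt 3) * (2 + sqrt 3) ^ k + (3 + sqrt 3) * (2 - sqrt 3) ^ k) / 6"

lemma sqrt_3_cancel: "sqrt 3 * (sqrt 3 * x) = 3 * x"
  by (simp add: mult.assoc[symmetric])

lemma rung_mode_0: "rung_mode 0 = 1"
  by (simp add: rung_mode_def)

lemma rung_mode_1: "rung_mode (Suc 0) = 1"
  by (simp add: rung_mode_def algebra_simps)

lemma rung_mode_times_6:
  "6 * rung_mode k = (3 - sqrt 3) * (2 + sqrt 3) ^ k + (3 + sqrt 3) * (2 - sqrt 3) ^ k"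
proof -
  have "6 * (x / 6) = x" for x :: real by simp
  then show ?thesis unfolding rung_mode_def .
qed

lemma rung_mode_rec: "rung_mode (Suc (Suc k)) = 4 * rung_mode (Suc k) - rung_mode k"
proof -
  have "(2 + sqrt 3) ^ Suc (Suc k) = 4 * (2 + sqrt 3) ^ Suc k - (2 + sqrt 3) ^ k"
    by (simp add: algebra_simps)
  moreover have "(2 - sqrt 3) ^ Suc (Suc k) = 4 * (2 - sqrt 3) ^ Suc k - (2 - sqrt 3) ^ k"
    by (simp add: algebra_simps)
  ultimately show ?thesis
    unfolding rung_mode_def by (simp only:) (simp add: field_simps)
qed

definition wronskian :: "nat \<Rightarrow> real" where
  "wronskian N = rung_mode (Suc N) - rung_mode N"

text \<open>
  The recurrence is symmetric under reflection, so this expression depends on the sum of the two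
  indices only, and it can be computed at \<open>i = 0\<close>.
\<close>

lemma wronskian_eq:
  "rung_mode (Suc i) * rung_mode (Suc m) - rung_mode i * rung_mode m = wronskian (i + m)"
proof (induction i arbitrary: m)
  case 0
  show ?case by (simp add: wronskian_def rung_mode_0 rung_mode_1)
next
  case (Suc i)
  show ?case using Suc.IH[of "Suc m"] by (simp add: rung_mode_rec algebra_simps)
qed

lemma wronskian_closed: "wronskian N = ((2 + sqrt 3) ^ N - (2 - sqrt 3) ^ N) / sqrt 3"
proof -
  let ?X = "(2 + sqrt 3) ^ N" and ?Y = "(2 - sqrt 3) ^ N"
  have "6 * wronskian N = 6 * rung_mode (Suc N) - 6 * rung_mode N"
    by (simp add: wronskian_def)
  also have "\<dots> = (3 - sqrt 3) * ((2 + sqrt 3) * ?X) + (3 + sqrt 3) * ((2 - sqrt 3) * ?Y)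
      - ((3 - sqrt 3) * ?X + (3 + sqrt 3) * ?Y)"
    by (simp only: rung_mode_times_6 power_Suc)
  finally have W6: "6 * wronskian N = (3 - sqrt 3) * ((2 + sqrt 3) * ?X) + (3 + sqrt 3) * ((2 - sqrt 3) * ?Y)
      - ((3 - sqrt 3) * ?X + (3 + sqrt 3) * ?Y)" .
  have "6 * (sqrt 3 * wronskian N) = sqrt 3 * (6 * wronskian N)"
    by simp
  also have "\<dots> = 6 * (?X - ?Y)"
    unfolding W6 by (simp add: algebra_simps sqrt_3_cancel)
  finally have "sqrt 3 * wronskian N = ?X - ?Y"
    by simp
  then show ?thesis by (simp add: field_simps)
qed

lemma wronskian_pos:
  assumes "N \<ge> 1"
  shows "wronskian N > 0"
proof -
  have "sqrt 3 < 2" by (rule real_less_lsqrt) auto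
  then have "(2 - sqrt 3) ^ N < (2 + sqrt 3) ^ N"
    using assms by (intro power_strict_mono) auto
  then show ?thesis by (simp add: wronskian_closed)
qed

text \<open>
  The classical Green's function of a second-order operator: to the left of \<open>j\<close> it is
  proportional to the solution adapted to the left end, to the right of \<open>j\<close> to its mirror
  image, and the Wronskian normalises the jump of the slope at \<open>j\<close>.
\<close>

definition rung_green :: "nat \<Rightarrow> nat \<Rightarrow> nat \<Rightarrow> real" where
  "rung_green N i j = rung_mode (min i j) * rung_mode (N + 1 - max i j) / wronskian N"

lemma screened_path_laplacian_rung_green:
  assumes "1 \<le> i" "i \<le> N" "1 \<le> j" "j \<le> N"
  shows "path_laplacian N (\<lambda>k. rung_green N k j) i + 2 * rung_green N i j = of_bool (i = j)"
proof -
  have W: "wronskian N \<noteq> 0" using wronskian_pos[of N] assms by simp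
  obtain k where k: "i = Suc k" using assms(1) by (cases i) auto
  obtain m where m: "N = i + m" using assms(2) le_Suc_ex by blast
  \<comment> \<open>No case distinction is left at the ends of the path, as the mode agrees at \<open>0\<close> and \<open>1\<close>.\<close>
  have left: "(if 1 < i then rung_mode i - rung_mode (i - 1) else 0) = rung_mode (Suc k) - rung_mode k"
    using k by (auto simp: rung_mode_0 rung_mode_1)
  have right: "(if i < N then rung_mode (N + 1 - i) - rung_mode (N - i) else 0)
      = rung_mode (Suc m) - rung_mode m"
    using m by (auto simp: rung_mode_0 rung_mode_1)
  consider "i < j" | "i > j" | "i = j" by linarith
  then show ?thesis
  proof cases
    case 1
    define C where "C = rung_mode (N + 1 - j) / wronskian N"
    have f: "rung_green N k' j = rung_mode k' * C" if "k' \<le> j" for k'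
      using that by (simp add: rung_green_def C_def min_def max_def)
    have "path_laplacian N (\<lambda>k. rung_green N k j) i
        = (if 1 < i then rung_mode i - rung_mode (i - 1) else 0) * C
          + (rung_mode i - rung_mode (Suc i)) * C"
      using 1 assms(4) by (simp add: path_laplacian_def f algebra_simps)
    also have "\<dots> = - 2 * rung_mode i * C"
      unfolding left unfolding k rung_mode_rec by (simp add: algebra_simps)
    finally show ?thesis using 1 by (simp add: f)
  next
    case 2
    define C where "C = rung_mode j / wronskian N"
    have f: "rung_green N k' j = rung_mode (N + 1 - k') * C" if "k' \<ge> j" for k'
      using that by (simp add: rung_green_def C_def min_def max_def)
    have idx: "N + 1 - (i - 1) = Suc (Suc m)" "N + 1 - i = Suc m" "N + 1 - (i + 1) = N - i"
      using m k by auto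
    have "path_laplacian N (\<lambda>k. rung_green N k j) i
        = (rung_mode (N + 1 - i) - rung_mode (N + 1 - (i - 1))) * C
          + (if i < N then rung_mode (N + 1 - i) - rung_mode (N - i) else 0) * C"
      using 2 assms(3) by (simp add: path_laplacian_def f algebra_simps)
    also have "\<dots> = - 2 * rung_mode (Suc m) * C"
      unfolding right unfolding idx rung_mode_rec by (simp add: algebra_simps)
    finally show ?thesis using 2 idx by (simp add: f)
  next
    case 3
    have "wronskian N * (path_laplacian N (\<lambda>k. rung_green N k j) i + 2 * rung_green N i j)
        = (if 1 < i then rung_mode i - rung_mode (i - 1) else 0) * rung_mode (N + 1 - i)
          + rung_mode i * (if i < N then rung_mode (N + 1 - i) - rung_mode (N - i) else 0)
          + 2 * rung_mode i * rung_mode (N + 1 - i)"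
      using W 3 by (simp add: path_laplacian_def rung_green_def min_def max_def field_simps)
    also have "\<dots> = rung_mode (Suc (Suc k)) * rung_mode (Suc m) - rung_mode (Suc k) * rung_mode m"
      unfolding left right using k m by (simp add: rung_mode_rec algebra_simps)
    also have "\<dots> = wronskian N"
      using wronskian_eq[of "Suc k" m] k m by simp
    finally show ?thesis using W 3 by simp
  qed
qed

text \<open>
  A unit mass at a vertex is half the sum of the even and the odd unit mass on its column, which
  accounts for the outer division by \<open>2\<close>.
\<close>

definition chain_green :: "nat \<Rightarrow> chain_vertex \<Rightarrow> chain_vertex \<Rightarrow> real" where
  "chain_green n x y =
     (- \<bar>real (column x) - real (column y)\<bar> / 2
      + side x * side y * rung_green (n + 1) (column x) (column y)) / 2"

lemma green_function_polyomino_chain: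
  "green_function (polyomino_chain n) (chain_green n)
     (\<lambda>x. (of_bool (column x = 1) + of_bool (column x = n + 1)) / 4)"
  unfolding green_function_def
proof (intro ballI)
  fix x y assume x: "x \<in> pverts (polyomino_chain n)" and y: "y \<in> pverts (polyomino_chain n)"
  have range: "1 \<le> column z" "column z \<le> n + 1" if "z \<in> pverts (polyomino_chain n)" for z
    using that by (auto simp: polyomino_chain_def)
  let ?L = "laplacian (polyomino_chain n)" and ?P = "path_laplacian (n + 1)"
  let ?i = "column x" and ?j = "column y"
  let ?f = "\<lambda>k. - \<bar>real k - real ?j\<bar> / 2" and ?h = "\<lambda>k. rung_green (n + 1) k ?j"
  have "?L (\<lambda>z. chain_green n z y) x
      = ?L (\<lambda>z. ?f (column z) + side z * (side y * ?h (column z))) x / 2"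
    by (simp add: laplacian_def chain_green_def sum_divide_distrib diff_divide_distrib mult_ac)
  also have "\<dots> = (?P ?f ?i + side x * (?P (\<lambda>k. side y * ?h k) ?i + 2 * (side y * ?h ?i))) / 2"
    by (subst laplacian_polyomino_chain[OF x]) simp
  also have "?P (\<lambda>k. side y * ?h k) ?i = side y * ?P ?h ?i"
    by (simp add: path_laplacian_def algebra_simps)
  also have "side y * ?P ?h ?i + 2 * (side y * ?h ?i) = side y * (?P ?h ?i + 2 * ?h ?i)"
    by (simp add: algebra_simps)
  also have "?P ?h ?i + 2 * ?h ?i = of_bool (?i = ?j)"
    using range x y by (intro screened_path_laplacian_rung_green) auto
  also have "?P ?f ?i = of_bool (?i = ?j) - (of_bool (?i = 1) + of_bool (?i = n + 1)) / 2"
    using range x y by (intro path_laplacian_distance) auto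
  finally have "?L (\<lambda>z. chain_green n z y) x
      = of_bool (?i = ?j) * (1 + side x * side y) / 2 - (of_bool (?i = 1) + of_bool (?i = n + 1)) / 4"
    by (simp add: field_simps)
  moreover have "of_bool (?i = ?j) * (1 + side x * side y) / 2 = (of_bool (x = y) :: real)"
    by (cases x; cases y) auto
  ultimately show "?L (\<lambda>z. chain_green n z y) x
      = of_bool (x = y) - (of_bool (?i = 1) + of_bool (?i = n + 1)) / 4"
    by simp
qed

section \<open>Evaluating the sums\<close>

text \<open>
  With \<open>2 + \<surd>3 = exp t\<close> this is \<open>coth (N t)\<close>; the powers of \<open>2 \<plusminus> \<surd>3\<close> enter the index only
  through this ratio.
\<close>

definition mode_ratio :: "nat \<Rightarrow> real" where
  "mode_ratio N = ((2 + sqrt 3) ^ N + (2 - sqrt 3) ^ N) / ((2 + sqrt 3) ^ N - (2 - sqrt 3) ^ N)"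

lemma mode_difference_nonzero:
  assumes "N \<ge> 1"
  shows "(2 + sqrt 3) ^ N - (2 - sqrt 3) ^ N \<noteq> 0"
  using wronskian_pos[OF assms] by (auto simp: wronskian_closed)

lemma rung_green_ends:
  assumes "N \<ge> 1"
  shows "rung_green N 1 1 = (sqrt 3 * mode_ratio N - 1) / 2"
    and "rung_green N N N = (sqrt 3 * mode_ratio N - 1) / 2"
proof -
  let ?X = "(2 + sqrt 3) ^ N" and ?Y = "(2 - sqrt 3) ^ N"
  have nz: "?X - ?Y \<noteq> 0" by (rule mode_difference_nonzero[OF assms])
  have "3 * (sqrt 3 * (2 * rung_mode N)) = sqrt 3 * (6 * rung_mode N)"
    by simp
  also have "\<dots> = 3 * (sqrt 3 * (?X + ?Y) - (?X - ?Y))"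
    unfolding rung_mode_times_6 by (simp add: algebra_simps sqrt_3_cancel)
  finally have "sqrt 3 * (2 * rung_mode N) = sqrt 3 * (?X + ?Y) - (?X - ?Y)"
    by (metis mult_left_cancel zero_neq_numeral)
  moreover have "2 * (rung_mode N / wronskian N) = sqrt 3 * (2 * rung_mode N) / (?X - ?Y)"
    by (simp add: wronskian_closed)
  ultimately have "2 * (rung_mode N / wronskian N) = sqrt 3 * mode_ratio N - 1"
    using nz by (simp add: mode_ratio_def diff_divide_distrib)
  moreover have "x = y / 2" if "2 * x = y" for x y :: real
    using that by simp
  ultimately have "rung_mode N / wronskian N = (sqrt 3 * mode_ratio N - 1) / 2"
    by blast
  then show "rung_green N 1 1 = (sqrt 3 * mode_ratio N - 1) / 2"
    and "rung_green N N N = (sqrt 3 * mode_ratio N - 1) / 2"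
    using assms by (simp_all add: rung_green_def rung_mode_1)
qed

text \<open>
  The products of the powers of \<open>2 \<plusminus> \<surd>3\<close> in \<open>rung_mode i * rung_mode (N + 1 - i)\<close> are of two kinds.
  Equal bases give the same value for every \<open>i\<close>; distinct bases combine, as
  \<open>(2 + \<surd>3) (2 - \<surd>3) = 1\<close>, to the terms of the factorisation of \<open>(2 + \<surd>3)\<^sup>N - (2 - \<surd>3)\<^sup>N\<close>.
\<close>

lemma sum_rung_green:
  assumes "N \<ge> 1"
  shows "(\<Sum>i=1..N. rung_green N i i) = (sqrt 3 * real N * mode_ratio N + 1) / 6"
proof -
  let ?q = "2 + sqrt 3" and ?p = "2 - sqrt 3"
  have product: "rung_mode (Suc i) * rung_mode (N - i)
      = (?q ^ N + ?p ^ N) / 6 + (?q ^ i * ?p ^ (N - Suc i) + ?p ^ i * ?q ^ (N - Suc i)) / 6"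
    if less: "i < N" for i
  proof -
    obtain m where m: "N = i + Suc m" using less_imp_Suc_add[OF less] by auto
    let ?S = "?q ^ N + ?p ^ N" and ?T = "?q ^ i * ?p ^ m + ?p ^ i * ?q ^ m"
    have "36 * (rung_mode (Suc i) * rung_mode (Suc m)) = (6 * rung_mode (Suc i)) * (6 * rung_mode (Suc m))"
      by simp
    also have "\<dots> = 6 * (?S + ?T)"
      unfolding rung_mode_times_6 m power_add power_Suc by (simp add: algebra_simps sqrt_3_cancel)
    finally have "36 * (rung_mode (Suc i) * rung_mode (Suc m)) = 6 * (?S + ?T)" .
    moreover have "x = S / 6 + T / 6" if "36 * x = 6 * (S + T)" for x S T :: real
      using that by simp
    ultimately have "rung_mode (Suc i) * rung_mode (Suc m) = ?S / 6 + ?T / 6"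
      by blast
    moreover have "N - i = Suc m" "N - Suc i = m"
      using m by auto
    ultimately show ?thesis by simp
  qed
  have geom: "(\<Sum>i<N. ?q ^ i * ?p ^ (N - Suc i)) = (?q ^ N - ?p ^ N) / (2 * sqrt 3)"
    "(\<Sum>i<N. ?p ^ i * ?q ^ (N - Suc i)) = (?q ^ N - ?p ^ N) / (2 * sqrt 3)"
    using power_diff_sumr2[of ?q N ?p] power_diff_sumr2[of ?p N ?q]
    by (simp_all add: field_simps)
  have "(\<Sum>i=1..N. rung_mode i * rung_mode (N + 1 - i)) = (\<Sum>i<N. rung_mode (Suc i) * rung_mode (N - i))"
    by (simp add: sum.atLeast1_atMost_eq)
  also have "\<dots> = real N * (?q ^ N + ?p ^ N) / 6 + (?q ^ N - ?p ^ N) / (6 * sqrt 3)"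
  proof -
    have halves: "(x / (2 * y) + x / (2 * y)) / 6 = x / (6 * y)" for x y :: real
      by simp
    have "(\<Sum>i<N. rung_mode (Suc i) * rung_mode (N - i))
        = (\<Sum>i<N. (?q ^ N + ?p ^ N) / 6
            + (?q ^ i * ?p ^ (N - Suc i) + ?p ^ i * ?q ^ (N - Suc i)) / 6)"
      by (intro sum.cong) (auto simp: product)
    also have "\<dots> = (\<Sum>i<N. (?q ^ N + ?p ^ N) / 6)
        + ((\<Sum>i<N. ?q ^ i * ?p ^ (N - Suc i)) + (\<Sum>i<N. ?p ^ i * ?q ^ (N - Suc i))) / 6"
      by (simp only: sum.distrib sum_divide_distrib[symmetric])
    finally show ?thesis
      unfolding geom halves by simp
  qed
  finally have conv: "(\<Sum>i=1..N. rung_mode i * rung_mode (N + 1 - i))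
      = real N * (?q ^ N + ?p ^ N) / 6 + (?q ^ N - ?p ^ N) / (6 * sqrt 3)" .
  have "(\<Sum>i=1..N. rung_green N i i) = (\<Sum>i=1..N. rung_mode i * rung_mode (N + 1 - i)) / wronskian N"
    by (simp add: rung_green_def sum_divide_distrib)
  also have "\<dots> = (sqrt 3 * real N * mode_ratio N + 1) / 6"
    unfolding conv wronskian_closed mode_ratio_def
    using mode_difference_nonzero[OF assms] by (simp add: field_simps)
  finally show ?thesis .
qed

text \<open>
  The degree in the strong prism of the four vertices of a column, provided that the two ends of the
  chain are distinct.
\<close>

definition column_weight :: "nat \<Rightarrow> nat \<Rightarrow> real" where
  "column_weight n i = 7 - 2 * of_bool (i = 1) - 2 * of_bool (i = n + 1)"

lemma sum_column_weight:
  "(\<Sum>i=1..n+1. column_weight n i * f i) = 7 * (\<Sum>i=1..n+1. f i) - 2 * f 1 - 2 * f (n + 1)"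
proof -
  have "(\<Sum>i=1..n+1. column_weight n i * f i)
      = (\<Sum>i=1..n+1. 7 * f i - 2 * (f i * of_bool (i = 1)) - 2 * (f i * of_bool (i = n + 1)))"
    by (simp add: column_weight_def algebra_simps)
  also have "\<dots> = 7 * (\<Sum>i=1..n+1. f i) - 2 * (\<Sum>i=1..n+1. f i * of_bool (i = 1))
      - 2 * (\<Sum>i=1..n+1. f i * of_bool (i = n + 1))"
    by (simp only: sum_subtractf sum_distrib_left)
  finally show ?thesis by (simp add: sum_mult_delta del: sum.cl_ivl_Suc)
qed

lemma sum_distance_to:
  assumes "j \<le> N"
  shows "(\<Sum>i=1..N. \<bar>real i - real j\<bar>)
    = (real j * (real j - 1) + (real N - real j) * (real N - real j + 1)) / 2"
  using assms
proof (induction N rule: dec_induct)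
  case base
  \<comment> \<open>The upper bound and the constant are kept apart, as only the former takes part in the induction.\<close>
  have countdown: "(\<Sum>i=1..m. c - real i) = real m * c - real m * (real m + 1) / 2" for m c
    by (induction m) (simp_all add: field_simps)
  have "(\<Sum>i=1..j. \<bar>real i - real j\<bar>) = (\<Sum>i=1..j. real j - real i)"
    by (intro sum.cong) auto
  also have "\<dots> = real j * real j - real j * (real j + 1) / 2"
    by (rule countdown)
  also have "\<dots> = real j * (real j - 1) / 2"
    by (simp add: field_simps)
  finally show ?case by simp
next
  case (step N)
  then show ?case by (simp add: field_simps)
qed

lemma sum_distance_all: "(\<Sum>j=1..N. \<Sum>i=1..N. \<bar>real i - real j\<bar>) = (real N ^ 3 - real N) / 3"
proof -
  \<comment> \<open>The length \<open>N\<close> also occurs in the summand; replacing it there by a free \<open>c\<close> allows induction.\<close>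
  have "(\<Sum>j=1..M. (real j * (real j - 1) + (c - real j) * (c - real j + 1)) / 2)
      = (2 * real M ^ 3 - 3 * c * real M ^ 2 + 3 * c ^ 2 * real M - 2 * real M) / 6" for M c
    by (induction M) (simp_all add: field_simps power2_eq_square power3_eq_cube)
  note this[of "real N" N]
  moreover have "(\<Sum>j=1..N. \<Sum>i=1..N. \<bar>real i - real j\<bar>)
      = (\<Sum>j=1..N. (real j * (real j - 1) + (real N - real j) * (real N - real j + 1)) / 2)"
    by (intro sum.cong sum_distance_to) auto
  ultimately show ?thesis
    by (simp add: field_simps power2_eq_square power3_eq_cube)
qed

lemma weighted_distance_sum:
  "(\<Sum>j=1..n+1. \<Sum>i=1..n+1. column_weight n i * column_weight n j * \<bar>real i - real j\<bar>)
   = 49 * real n * (real n + 1) * (real n + 2) / 3 - 28 * real n * (real n + 1) + 8 * real n"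
proof -
  let ?D = "\<lambda>j. \<Sum>i=1..n+1. \<bar>real i - real j\<bar>"
  have inner: "(\<Sum>i=1..n+1. column_weight n i * \<bar>real i - real j\<bar>) = 7 * ?D j - 2 * real n"
    if "j \<in> {1..n+1}" for j
    using that sum_column_weight[of n "\<lambda>i. \<bar>real i - real j\<bar>"] by (simp del: sum.cl_ivl_Suc)
  have "(\<Sum>j=1..n+1. \<Sum>i=1..n+1. column_weight n i * column_weight n j * \<bar>real i - real j\<bar>)
      = (\<Sum>j=1..n+1. column_weight n j * (\<Sum>i=1..n+1. column_weight n i * \<bar>real i - real j\<bar>))"
    by (simp add: sum_distrib_left mult_ac del: sum.cl_ivl_Suc)
  also have "\<dots> = (\<Sum>j=1..n+1. column_weight n j * (7 * ?D j - 2 * real n))"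
    by (intro sum.cong refl) (simp only: inner)
  also have "\<dots> = 7 * (7 * (\<Sum>j=1..n+1. ?D j) - 2 * real n * (real n + 1))
      - 2 * (7 * ?D 1 - 2 * real n) - 2 * (7 * ?D (n + 1) - 2 * real n)"
    unfolding sum_column_weight by (simp add: sum_subtractf sum_distrib_left del: sum.cl_ivl_Suc)
  also have "\<dots> = 49 * real n * (real n + 1) * (real n + 2) / 3 - 28 * real n * (real n + 1) + 8 * real n"
    unfolding sum_distance_all using sum_distance_to[of 1 "n + 1"] sum_distance_to[of "n + 1" "n + 1"]
    by (simp add: field_simps power2_eq_square power3_eq_cube del: sum.cl_ivl_Suc)
  finally show ?thesis .
qed

theorem theorem3p4:
  fixes n :: nat and l :: "nat \<Rightarrow> chain_vertex \<times> bool"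
  assumes "n \<ge> 1"
    and "bij_betw l {1..card (pverts (strong_prism (polyomino_chain n)))}
           (pverts (strong_prism (polyomino_chain n)))"
  shows "degree_kirchhoff_index (strong_prism (polyomino_chain n)) l =
    (sqrt 3 * (7 * real n - 9) * (7 * real n + 3) *
        ((2 + sqrt 3) ^ (n + 1) + (2 - sqrt 3) ^ (n + 1))
      - 4 * (7 * real n + 3) * ((2 + sqrt 3) ^ n - (2 - sqrt 3) ^ n))
      / (3 * ((2 + sqrt 3) ^ (n + 1) - (2 - sqrt 3) ^ (n + 1)))
    + 49 / 3 * real n ^ 3 + 70 * real n ^ 2 + 141 * real n + 46"
proof -
  let ?G = "polyomino_chain n" and ?w = "column_weight n" and ?R = "mode_ratio (n + 1)"
  have deg: "degree ?G (U i) = 3 - of_bool (i = 1) - of_bool (i = n + 1)"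
    "degree ?G (V i) = 3 - of_bool (i = 1) - of_bool (i = n + 1)" if "i \<in> {1..n+1}" for i
    using that degree_polyomino_chain[OF assms(1), of "U i"] degree_polyomino_chain[OF assms(1), of "V i"]
    by (auto simp: polyomino_chain_def)
  have w: "2 * degree ?G (U i) + 1 = ?w i" "2 * degree ?G (V i) + 1 = ?w i" if "i \<in> {1..n+1}" for i
    using that by (auto simp: deg column_weight_def)
  have total: "(\<Sum>u \<in> pverts ?G. 2 * degree ?G u + 1) = 2 * (7 * real n + 3)"
  proof -
    have "(\<Sum>u \<in> pverts ?G. 2 * degree ?G u + 1) = (\<Sum>i=1..n+1. ?w i * 2)"
      unfolding sum_pverts_polyomino_chain by (intro sum.cong refl) (simp only: w)
    then show ?thesis by (simp only: sum_column_weight) (simp add: algebra_simps)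
  qed
  have trace: "(\<Sum>u \<in> pverts ?G. (2 * degree ?G u + 1) * chain_green n u u)
      = 7 * (sqrt 3 * (real n + 1) * ?R + 1) / 6 - 2 * (sqrt 3 * ?R - 1)"
  proof -
    have "(\<Sum>u \<in> pverts ?G. (2 * degree ?G u + 1) * chain_green n u u)
        = (\<Sum>i=1..n+1. ?w i * rung_green (n + 1) i i)"
      unfolding sum_pverts_polyomino_chain
      by (intro sum.cong refl) (simp only: w, simp add: chain_green_def)
    also have "\<dots> = 7 * (sqrt 3 * (real n + 1) * ?R + 1) / 6 - 2 * (sqrt 3 * ?R - 1)"
      using rung_green_ends[of "n + 1"] sum_rung_green[of "n + 1"]
      by (simp only: sum_column_weight) (simp add: field_simps del: sum.cl_ivl_Suc)
    finally show ?thesis .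
  qed
  have twins: "(\<Sum>u \<in> pverts ?G. (2 * degree ?G u + 1) / (degree ?G u + 1)) = 7 * (real n + 1) / 2 - 1 / 3"
  proof -
    have "(\<Sum>u \<in> pverts ?G. (2 * degree ?G u + 1) / (degree ?G u + 1))
        = (\<Sum>i=1..n+1. 7 / 2 - (1 * of_bool (i = 1)) / 6 - (1 * of_bool (i = n + 1)) / 6)"
      unfolding sum_pverts_polyomino_chain
      using assms(1) by (intro sum.cong refl) (auto simp: deg)
    also have "\<dots> = 7 * (real n + 1) / 2 - 1 / 3"
      unfolding sum_subtractf sum_divide_distrib[symmetric]
      by (subst sum_mult_delta, simp, simp)+ (simp add: field_simps)
    finally show ?thesis .
  qed
  have double: "(\<Sum>u \<in> pverts ?G. \<Sum>v \<in> pverts ?G.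
        (2 * degree ?G u + 1) * (2 * degree ?G v + 1) * chain_green n u v)
      = - (49 * real n * (real n + 1) * (real n + 2) / 3 - 28 * real n * (real n + 1) + 8 * real n)"
  proof -
    have cancel: "(a * b * chain_green n (U j) (U i) + a * b * chain_green n (U j) (V i))
        + (a * b * chain_green n (V j) (U i) + a * b * chain_green n (V j) (V i))
        = - (b * a * \<bar>real i - real j\<bar>)" for a b i j
      by (simp add: chain_green_def algebra_simps abs_minus_commute)
    have "(\<Sum>u \<in> pverts ?G. \<Sum>v \<in> pverts ?G.
        (2 * degree ?G u + 1) * (2 * degree ?G v + 1) * chain_green n u v)
      = (\<Sum>j=1..n+1. \<Sum>i=1..n+1. - (?w i * ?w j * \<bar>real i - real j\<bar>))"
      unfolding sum_pverts_polyomino_chain sum.distrib[symmetric]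
      by (intro sum.cong refl) (simp only: w cancel)
    then show ?thesis by (simp only: sum_negf weighted_distance_sum)
  qed
  let ?X = "(2 + sqrt 3) ^ (n + 1)" and ?Y = "(2 - sqrt 3) ^ (n + 1)"
  have nz: "?X - ?Y \<noteq> 0" by (rule mode_difference_nonzero) simp
  \<comment> \<open>Multiplication by \<open>2 - \<surd>3\<close> and \<open>2 + \<surd>3\<close>, respectively, lowers the exponents from \<open>n + 1\<close> to \<open>n\<close>;
     thereby the second term of the numerator becomes a combination of the other two sums of powers.\<close>
  have shift: "(2 + sqrt 3) ^ n - (2 - sqrt 3) ^ n = 2 * (?X - ?Y) - sqrt 3 * (?X + ?Y)"
    by (simp add: algebra_simps sqrt_3_cancel)
  have combine: "2 - s * (S / D) = (2 * D - s * S) / D" if "D \<noteq> 0" for s S D :: real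
    using that by (simp add: diff_divide_distrib)
  have gather: "(A * (S / D) - B * (T / D)) / 3 = (A * S - B * T) / (3 * D)" for A B S T D :: real
    by (simp add: diff_divide_distrib)
  have "degree_kirchhoff_index (strong_prism ?G) l
      = 2 * (7 * real n + 3) * (7 * (sqrt 3 * (real n + 1) * ?R + 1) / 6 - 2 * (sqrt 3 * ?R - 1)
          + (7 * (real n + 1) / 2 - 1 / 3))
        + (49 * real n * (real n + 1) * (real n + 2) / 3 - 28 * real n * (real n + 1) + 8 * real n)"
    using degree_kirchhoff_index_strong_prism[OF polyomino_chain_pair_graph
        green_function_polyomino_chain assms(2)]
    unfolding total trace twins double by simp
  also have "\<dots> = (sqrt 3 * (7 * real n - 9) * (7 * real n + 3) * ?R
        - 4 * (7 * real n + 3) * (2 - sqrt 3 * ?R)) / 3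
      + 49 / 3 * real n ^ 3 + 70 * real n ^ 2 + 141 * real n + 46"
    by (simp add: field_simps power2_eq_square power3_eq_cube)
  also have "2 - sqrt 3 * ?R = (2 * (?X - ?Y) - sqrt 3 * (?X + ?Y)) / (?X - ?Y)"
    unfolding mode_ratio_def by (rule combine[OF nz])
  finally show ?thesis
    unfolding shift mode_ratio_def gather .
qed

end
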